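(* For every integer $n\ge1$, the fourth moment about the mean, $E[(X_n-E[X_n])^4]$, of the number $X_n$ of swaps of Quicksort for a list of length $n$ under Variant I is $$\frac1{18}n(335n^3+1568n^2+3067n+2770)-3(n+1)(4n^2+8n+9)H_1(n)+3(n+1)^2H_1(n)^2$$ $$+\left(-(12n^2+24n+19)(n+1)^2+6(n+1)^3H_1(n)\right)H_2(n)+3(n+1)^4H_2(n)^2-12(n+1)^3H_3(n)-6(n+1)^4H_4(n).$$
   Context: $H_k(n)=\sum_{i=1}^n \frac1{i^k}$. Variant I of Quicksort, applied to a uniformly random ordering of $n$ distinct elements: the first element of the list is the pivot; every other element is compared with the pivot and, if smaller than the pivot, it is removed and inserted before the pivot (this counts as one swap); then the procedure is applied recursively to the sublists of elements before and after the pivot. Thus partitioning costs $k-1$ swaps when the pivot is the $k$-th smallest element. $X_n$ is the total number of swaps. Formally, the probability generating function $P_n(t)=\sum_{m\ge0}P(X_n=m)t^m$ is determined by $P_0(t)=P_1(t)=1$ and $P_n(t)=\frac1n\sum_{k=1}^n P_{k-1}(t)P_{n-k}(t)\,t^{k-1}$ for $n\ge2$. *)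

theory Defs
  imports "HOL-Probability.Probability"
begin

text \<open>
  One partitioning stage with pivot \<open>p\<close>: the list \<open>p # xs\<close> is rearranged into
  \<open>bs @ p # as\<close>, where \<open>partition_stage p xs = (bs, as, s)\<close> and \<open>s\<close> is the number of
  swaps. The elements of \<open>xs\<close> are compared with \<open>p\<close> from left to right; an element smaller
  than \<open>p\<close> is removed and inserted immediately before \<open>p\<close>, which is one swap. Thus both
  sublists keep the relative order of the original list.
\<close>

primrec partition_stage :: "'a::linorder \<Rightarrow> 'a list \<Rightarrow> 'a list \<times> 'a list \<times> nat" where
  "partition_stage p [] = ([], [], 0)"
| "partition_stage p (x # xs) =
     (case partition_stage p xs of (bs, as, s) \<Rightarrow>
        if x < p then (x # bs, as, Suc s) else (bs, x # as, s))"

lemma partition_stage_length: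
  "partition_stage p xs = (bs, as, s) \<Longrightarrow> length bs + length as = length xs"
  by (induction xs arbitrary: bs as s) (auto split: prod.splits if_splits)

function quicksort_swaps :: "'a::linorder list \<Rightarrow> nat" where
  "quicksort_swaps [] = 0"
| "quicksort_swaps (p # xs) =
     (case partition_stage p xs of (bs, as, s) \<Rightarrow>
        s + quicksort_swaps bs + quicksort_swaps as)"
  by pat_completeness auto
termination
  by (relation "Wellfounded.measure length") (auto dest!: partition_stage_length[OF sym])

text \<open>The distribution of the number of swaps for a uniformly random ordering of the elements
  of the finite set \<open>A\<close>.\<close>

definition swaps_pmf :: "'a::linorder set \<Rightarrow> nat pmf" where
  "swaps_pmf A = map_pmf quicksort_swaps (pmf_of_set (permutations_of_set A))"

definition mean :: "nat pmf \<Rightarrow> real" where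
  "mean X = measure_pmf.expectation X real"

definition central_moment :: "nat \<Rightarrow> nat pmf \<Rightarrow> real" where
  "central_moment r X = measure_pmf.expectation X (\<lambda>x. (real x - mean X) ^ r)"

definition H :: "nat \<Rightarrow> nat \<Rightarrow> real" where
  "H k n = (\<Sum>i=1..n. 1 / real i ^ k)"

end

theory Submission
  imports Defs
begin

text \<open>
  Conditioning on the pivot, whose rank is uniform, the number of swaps satisfies
  \<open>X(n) = k + X(k) + X'(n - 1 - k)\<close> with \<open>k\<close> uniform on \<open>{0..<n}\<close> and independent summands,
  because the elements below and above the pivot are left in independent uniformly random
  orders (\<open>swaps_pmf_rec\<close>, \<open>swaps_pmf_eq_swaps_law\<close>).

  The moments are taken in the binomial basis, \<open>b_r(n) = E[X(n) choose r]\<close>: Vandermonde's identity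
  then splits the moment of a sum without cross terms, and the recurrence becomes a
  convolution (\<open>binomial_moment_rec\<close>). For the generating functions
  \<open>F_r(z) = \<Sum>n. b_r(n) z\<^sup>n\<close> this reads
  \<open>F_r' = \<Sum>i\<le>r. \<Sum>j\<le>i. (z\<^sup>j/j! * D\<^sup>j F_(i-j)) * F_(r-i)\<close>, where \<open>D\<close> is differentiation
  (\<open>deriv_moment_fps\<close>). Since \<open>F_0 = 1/(1 - z)\<close>, for \<open>r \<ge> 1\<close> the unknown \<open>F_r\<close> enters only
  through \<open>2/(1 - z) * F_r\<close>; the equation is linear of first order and has exactly one solution that
  vanishes at 0 (\<open>linear_ode_unique\<close>).

  The ring generated by \<open>w = 1/(1 - z)\<close> and \<open>L = log(1/(1 - z))\<close> is closed under
  differentiation and under \<open>z d/dz\<close>, as \<open>w' = w\<^sup>2\<close>, \<open>L' = w\<close> and \<open>z w = w - 1\<close>. It contains the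
  solutions for \<open>r \<le> 4\<close>, and checking a candidate is a polynomial identity in \<open>w\<close> and \<open>L\<close>
  (\<open>moment_fps_1\<close> to \<open>moment_fps_4\<close>). Finally, the coefficients of \<open>w\<^sup>m L\<^sup>k\<close> are polynomials in \<open>n\<close>
  and harmonic numbers (\<open>geo_lg_power_nth\<close>, \<open>geo_lg_coeff_Suc\<close>), which makes the binomial
  moments explicit, and the fourth central moment is a polynomial in those
  (\<open>central_moment_4_eq\<close>).
\<close>

unbundle no vec_syntax
unbundle fps_syntax

section \<open>The law of the number of swaps\<close>

lemma partition_stage_eq:
  "partition_stage p xs =
     (filter (\<lambda>x. x < p) xs, filter (\<lambda>x. \<not> x < p) xs, length (filter (\<lambda>x. x < p) xs))"
  by (induction xs) auto

text \<open>
  Splitting a uniformly random ordering by the predicate "smaller than the pivot", keeping relative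
  orders, yields two independent uniformly random orderings; this is exactly what one
  partitioning stage does to the list after its first element.
\<close>

lemma swaps_pmf_rec:
  assumes "finite A" "A \<noteq> {}"
  shows "swaps_pmf A = pmf_of_set A \<bind> (\<lambda>p. map_pmf (\<lambda>(x, y). card {a \<in> A. a < p} + x + y)
           (pair_pmf (swaps_pmf {a \<in> A. a < p}) (swaps_pmf {a \<in> A. p < a})))"
proof -
  have "swaps_pmf A = pmf_of_set A \<bind> (\<lambda>p. map_pmf (\<lambda>xs. quicksort_swaps (p # xs))
          (pmf_of_set (permutations_of_set (A - {p}))))"
    unfolding swaps_pmf_def random_permutation_of_set[OF assms]
    by (simp add: map_bind_pmf map_pmf_def bind_assoc_pmf bind_return_pmf)
  also have "\<dots> = pmf_of_set A \<bind> (\<lambda>p. map_pmf (\<lambda>(x, y). card {a \<in> A. a < p} + x + y)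
           (pair_pmf (swaps_pmf {a \<in> A. a < p}) (swaps_pmf {a \<in> A. p < a})))"
  proof (rule bind_pmf_cong[OF refl])
    fix p assume "p \<in> set_pmf (pmf_of_set A)"
    then have p: "p \<in> A" using assms by simp
    have less: "{a \<in> A - {p}. a < p} = {a \<in> A. a < p}"
      and greater: "{a \<in> A - {p}. \<not> a < p} = {a \<in> A. p < a}" by auto
    have "map_pmf (\<lambda>xs. quicksort_swaps (p # xs)) (pmf_of_set (permutations_of_set (A - {p})))
        = map_pmf (\<lambda>(bs, as). length bs + quicksort_swaps bs + quicksort_swaps as)
            (map_pmf (partition (\<lambda>x. x < p)) (pmf_of_set (permutations_of_set (A - {p}))))"
      by (simp add: map_pmf_comp partition_stage_eq o_def)
    also have "\<dots> = map_pmf (\<lambda>(bs, as). length bs + quicksort_swaps bs + quicksort_swaps as)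
        (pair_pmf (pmf_of_set (permutations_of_set {a \<in> A. a < p}))
                  (pmf_of_set (permutations_of_set {a \<in> A. p < a})))"
      using assms by (subst partition_random_permutations) (simp_all only: less greater finite_Diff)
    also have "\<dots> = map_pmf (\<lambda>(bs, as). card {a \<in> A. a < p} + quicksort_swaps bs + quicksort_swaps as)
        (pair_pmf (pmf_of_set (permutations_of_set {a \<in> A. a < p}))
                  (pmf_of_set (permutations_of_set {a \<in> A. p < a})))"
      using assms by (intro map_pmf_cong) (auto simp: length_finite_permutations_of_set)
    also have "\<dots> = map_pmf (\<lambda>(x, y). card {a \<in> A. a < p} + x + y)
           (pair_pmf (swaps_pmf {a \<in> A. a < p}) (swaps_pmf {a \<in> A. p < a}))"
      unfolding swaps_pmf_def map_pair[symmetric]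
      by (simp add: map_pmf_comp case_prod_unfold)
    finally show "map_pmf (\<lambda>xs. quicksort_swaps (p # xs)) (pmf_of_set (permutations_of_set (A - {p})))
       = map_pmf (\<lambda>(x, y). card {a \<in> A. a < p} + x + y)
           (pair_pmf (swaps_pmf {a \<in> A. a < p}) (swaps_pmf {a \<in> A. p < a}))" .
  qed
  finally show ?thesis .
qed

lemma rank_uniform:
  fixes A :: "'a::linorder set"
  assumes "finite A" "A \<noteq> {}"
  shows "map_pmf (\<lambda>p. card {a \<in> A. a < p}) (pmf_of_set A) = pmf_of_set {..<card A}"
proof -
  have mono: "card {a \<in> A. a < p} < card {a \<in> A. a < q}" if "p \<in> A" "p < q" for p q
    using that assms by (intro psubset_card_mono) auto
  have inj: "inj_on (\<lambda>p. card {a \<in> A. a < p}) A"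
    by (rule linorder_inj_onI') (use mono in force)
  have sub: "(\<lambda>p. card {a \<in> A. a < p}) ` A \<subseteq> {..<card A}"
    using assms by (auto intro!: psubset_card_mono)
  have "(\<lambda>p. card {a \<in> A. a < p}) ` A = {..<card A}"
    by (rule card_subset_eq[OF _ sub]) (simp_all add: card_image[OF inj])
  with map_pmf_of_set_inj[OF inj] assms show ?thesis by simp
qed

text \<open>
  The recursion of Quicksort runs over the sets of elements below and above the pivot. Only their
  cardinalities matter, so the law can be described by a recursion over natural numbers, in which
  \<open>k\<close> is the number of elements below the pivot.
\<close>

function swaps_law :: "nat \<Rightarrow> nat pmf" where
  "swaps_law n = (if n = 0 then return_pmf 0 else
     pmf_of_set {..<n} \<bind> (\<lambda>k. map_pmf (\<lambda>(x, y). k + x + y)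
       (pair_pmf (swaps_law k) (swaps_law (n - 1 - k)))))"
  by auto
termination by (relation "Wellfounded.measure id") (auto simp: lessThan_empty_iff)

declare swaps_law.simps [simp del]

lemma swaps_pmf_eq_swaps_law: "finite A \<Longrightarrow> swaps_pmf A = swaps_law (card A)"
proof (induction "card A" arbitrary: A rule: less_induct)
  case (less A)
  show ?case
  proof (cases "A = {}")
    case True
    then show ?thesis
      by (simp add: swaps_pmf_def swaps_law.simps pmf_of_set_singleton)
  next
    case False
    define rank where "rank = (\<lambda>p. card {a \<in> A. a < p})"
    have rank: "swaps_pmf {a \<in> A. a < p} = swaps_law (rank p)"
      "swaps_pmf {a \<in> A. p < a} = swaps_law (card A - 1 - rank p)" if "p \<in> A" for p
    proof -
      have "A = insert p ({a \<in> A. a < p} \<union> {a \<in> A. p < a})" using that by auto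
      then have "card A = card (insert p ({a \<in> A. a < p} \<union> {a \<in> A. p < a}))" by metis
      also have "\<dots> = Suc (card ({a \<in> A. a < p} \<union> {a \<in> A. p < a}))"
        using less.prems by (subst card_insert_disjoint) auto
      also have "card ({a \<in> A. a < p} \<union> {a \<in> A. p < a}) = rank p + card {a \<in> A. p < a}"
        using less.prems unfolding rank_def by (intro card_Un_disjoint) auto
      finally have "card A = Suc (rank p + card {a \<in> A. p < a})" .
      then show "swaps_pmf {a \<in> A. a < p} = swaps_law (rank p)"
        "swaps_pmf {a \<in> A. p < a} = swaps_law (card A - 1 - rank p)"
        using less.hyps[of "{a \<in> A. a < p}"] less.hyps[of "{a \<in> A. p < a}"] less.prems
        by (simp_all add: rank_def)
    qed
    have "swaps_pmf A = pmf_of_set A \<bind> (\<lambda>p. map_pmf (\<lambda>(x, y). rank p + x + y)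
            (pair_pmf (swaps_law (rank p)) (swaps_law (card A - 1 - rank p))))"
      unfolding swaps_pmf_rec[OF less.prems False]
      using less.prems False by (intro bind_pmf_cong refl) (simp add: rank, simp add: rank_def)
    also have "\<dots> = map_pmf rank (pmf_of_set A) \<bind> (\<lambda>k. map_pmf (\<lambda>(x, y). k + x + y)
            (pair_pmf (swaps_law k) (swaps_law (card A - 1 - k))))"
      by (simp add: bind_map_pmf)
    also have "\<dots> = swaps_law (card A)"
      using rank_uniform[OF less.prems False] less.prems False
      by (subst swaps_law.simps[of "card A"]) (simp add: rank_def)
    finally show ?thesis .
  qed
qed

lemma finite_set_pmf_swaps_law: "finite (set_pmf (swaps_law n))"
proof (induction n rule: less_induct)
  case (less n)
  then show ?case
    by (subst swaps_law.simps) (auto simp: lessThan_empty_iff)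
qed

section \<open>Binomial moments\<close>

text \<open>
  Binomial coefficients serve as the basis of test functions because they are of binomial type:
  the value at a sum is a convolution of the values at the summands.
\<close>

definition binomial_moment :: "nat \<Rightarrow> nat \<Rightarrow> real" where
  "binomial_moment r n = measure_pmf.expectation (swaps_law n) (\<lambda>x. real (x choose r))"

lemma expectation_pair_pmf_mult:
  fixes f :: "'a \<Rightarrow> real" and g :: "'b \<Rightarrow> real"
  assumes "finite (set_pmf p)" "finite (set_pmf q)"
  shows "measure_pmf.expectation (pair_pmf p q) (\<lambda>z. f (fst z) * g (snd z)) =
    measure_pmf.expectation p f * measure_pmf.expectation q g"
proof -
  have "measure_pmf.expectation (pair_pmf p q) (\<lambda>z. f (fst z) * g (snd z)) =
     (\<Sum>x\<in>set_pmf p. pmf p x * (f x * measure_pmf.expectation q g))"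
    unfolding pair_pmf_def using assms
    by (subst pmf_expectation_bind[of "set_pmf p"])
       (auto simp: map_pmf_def[symmetric])
  also have "\<dots> = measure_pmf.expectation p f * measure_pmf.expectation q g"
    using assms by (simp add: integral_measure_pmf[of "set_pmf p" p f] sum_distrib_right mult.assoc)
  finally show ?thesis .
qed

lemma vandermonde3:
  "(k + x + y) choose r = (\<Sum>i\<le>r. \<Sum>j\<le>i. (k choose j) * (x choose (i - j)) * (y choose (r - i)))"
  by (simp add: vandermonde[symmetric] sum_distrib_right)

lemma binomial_moment_rec:
  assumes "n > 0"
  shows "real n * binomial_moment r n =
    (\<Sum>k<n. \<Sum>i\<le>r. \<Sum>j\<le>i. real (k choose j) *
       binomial_moment (i - j) k * binomial_moment (r - i) (n - 1 - k))"
proof -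
  have int: "integrable (measure_pmf (pair_pmf (swaps_law k) (swaps_law l))) f"
    for f :: "_ \<Rightarrow> real" and k l
    by (rule integrable_measure_pmf_finite) (simp add: finite_set_pmf_swaps_law)
  have "binomial_moment r n = (\<Sum>k<n. measure_pmf.expectation
       (pair_pmf (swaps_law k) (swaps_law (n - 1 - k)))
       (\<lambda>z. real ((k + fst z + snd z) choose r)) / real n)"
    unfolding binomial_moment_def using assms
    by (subst swaps_law.simps, simp, subst pmf_expectation_bind_pmf_of_set)
       (auto simp: finite_set_pmf_swaps_law lessThan_empty_iff case_prod_unfold divide_inverse mult_ac)
  also have "\<dots> = (\<Sum>k<n. (\<Sum>i\<le>r. \<Sum>j\<le>i. real (k choose j) *
      (binomial_moment (i - j) k * binomial_moment (r - i) (n - 1 - k))) / real n)"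
    unfolding vandermonde3 of_nat_sum of_nat_mult mult.assoc binomial_moment_def
    by (simp add: int Bochner_Integration.integral_sum Bochner_Integration.integrable_sum
       expectation_pair_pmf_mult[where f = "\<lambda>x. real (x choose a)"
         and g = "\<lambda>y. real (y choose b)" for a b]
       finite_set_pmf_swaps_law)
  finally show ?thesis using assms by (simp add: sum_divide_distrib[symmetric] mult.assoc)
qed

section \<open>Euler's operator on power series\<close>

definition theta :: "real fps \<Rightarrow> real fps" where
  "theta f = fps_X * fps_deriv f"

lemma theta_nth: "theta f $ n = real n * f $ n"
  by (cases n) (simp_all add: theta_def)

lemma theta_add: "theta (f + g) = theta f + theta g"
  and theta_diff: "theta (f - g) = theta f - theta g"
  and theta_minus: "theta (- f) = - theta f"
  and theta_mult: "theta (f * g) = theta f * g + f * theta g"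
  and theta_power: "theta (f ^ n) = of_nat n * theta f * f ^ (n - 1)"
  and theta_numeral: "theta (numeral k) = 0"
  by (simp_all add: theta_def algebra_simps fps_deriv_power')

text \<open>
  This is the operator \<open>z\<^sup>j/j! * (d/dz)\<^sup>j\<close>. It arises because a pivot with \<open>k\<close> smaller elements
  contributes the deterministic amount \<open>k\<close>, hence a factor \<open>k choose j\<close>, to a binomial moment.
\<close>

definition binomial_theta :: "nat \<Rightarrow> real fps \<Rightarrow> real fps" where
  "binomial_theta j f = Abs_fps (\<lambda>n. real (n choose j) * f $ n)"

lemma binomial_theta_0: "binomial_theta 0 f = f"
  by (rule fps_ext) (simp add: binomial_theta_def)

text \<open>
  Absorption, \<open>(j + 1) (n choose j + 1) = (n - j) (n choose j)\<close>, read as an identity of operators: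
  it reduces these operators to polynomials in \<open>theta\<close>.
\<close>

lemma binomial_theta_Suc:
  "of_nat (Suc j) * binomial_theta (Suc j) f = theta (binomial_theta j f) - of_nat j * binomial_theta j f"
proof (rule fps_ext)
  fix n
  have "real (Suc j) * real (n choose Suc j) = (real n - real j) * real (n choose j)"
  proof (cases "j \<le> n")
    case True
    have "Suc j * (n choose Suc j) = (n - j) * (n choose j)"
      by (simp only: binomial_absorption binomial_absorb_comp)
    then have "real (Suc j * (n choose Suc j)) = real ((n - j) * (n choose j))" by (rule arg_cong)
    then show ?thesis using True by (simp only: of_nat_mult of_nat_diff)
  qed (simp add: binomial_eq_0)
  then have "real (Suc j) * real (n choose Suc j) * f $ n = (real n - real j) * real (n choose j) * f $ n"
    by (rule arg_cong)
  then show "(of_nat (Suc j) * binomial_theta (Suc j) f) $ n =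
     (theta (binomial_theta j f) - of_nat j * binomial_theta j f) $ n"
    unfolding fps_of_nat[symmetric] fps_sub_nth fps_mult_left_const_nth theta_nth
    by (simp add: binomial_theta_def left_diff_distrib mult.assoc del: of_nat_Suc)
qed

section \<open>The geometric and the logarithmic series\<close>

definition geo :: "real fps" where "geo = Abs_fps (\<lambda>_. 1)"

text \<open>
  This is \<open>L = log(1/(1 - z))\<close>: the antiderivative of \<open>w = 1/(1 - z)\<close> without constant term.
\<close>

definition lg :: "real fps" where "lg = fps_integral0 geo"

lemma one_minus_X_geo: "(1 - fps_X) * geo = 1"
  unfolding geo_def fps_inverse_gp'[symmetric] by (rule inverse_mult_eq_1) simp

lemma X_geo: "fps_X * geo = geo - 1"
  using one_minus_X_geo by (simp add: algebra_simps)

lemma deriv_geo: "fps_deriv geo = geo ^ 2"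
proof -
  have "fps_deriv ((1 - fps_X) * geo) = 0" by (simp add: one_minus_X_geo)
  then have "(1 - fps_X) * fps_deriv geo = geo" by simp
  then have "geo * ((1 - fps_X) * fps_deriv geo) = geo ^ 2" by (simp add: power2_eq_square)
  then have "((1 - fps_X) * geo) * fps_deriv geo = geo ^ 2" by (simp only: mult_ac)
  then show ?thesis by (simp add: one_minus_X_geo)
qed

lemma deriv_lg: "fps_deriv lg = geo"
  by (simp add: lg_def fps_deriv_fps_integral)

lemma theta_geo: "theta geo = geo ^ 2 - geo"
proof -
  have "theta geo = (fps_X * geo) * geo" by (simp add: theta_def deriv_geo power2_eq_square mult.assoc)
  then show ?thesis unfolding X_geo by (simp add: power2_eq_square left_diff_distrib)
qed

lemma theta_lg: "theta lg = geo - 1"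
  by (simp add: theta_def deriv_lg X_geo)

lemma geo_mult_Suc: "(geo * f) $ Suc n = (geo * f) $ n + f $ Suc n"
proof -
  have "f = ((1 - fps_X) * geo) * f" by (simp add: one_minus_X_geo)
  then have "f = geo * f - fps_X * (geo * f)" by (simp add: algebra_simps)
  then have "f $ Suc n = (geo * f - fps_X * (geo * f)) $ Suc n" by metis
  then show ?thesis by simp
qed

text \<open>
  Multiplication by \<open>1/(1 - z)\<close> takes partial sums, and \<open>(L^k)' = k w L^(k - 1)\<close> gives the
  increments of the partial sums in terms of the previous power.
\<close>

lemma geo_lg_power_Suc:
  "(geo * lg ^ k) $ Suc n = (geo * lg ^ k) $ n + real k / real (Suc n) * (geo * lg ^ (k - 1)) $ n"
proof -
  have "real (Suc n) * (lg ^ k) $ Suc n = fps_deriv (lg ^ k) $ n" by simp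
  also have "\<dots> = real k * (geo * lg ^ (k - 1)) $ n"
    by (simp add: fps_deriv_power' deriv_lg fps_of_nat[symmetric] mult.assoc)
  finally show ?thesis by (simp add: geo_mult_Suc field_simps)
qed

lemma geo_lg_power_0: "k > 0 \<Longrightarrow> (geo * lg ^ k) $ 0 = 0"
  by (simp add: lg_def)

text \<open>
  The coefficients of \<open>w L\<^sup>k\<close> are \<open>k!\<close> times the elementary symmetric functions of
  \<open>1, 1/2, ..., 1/n\<close>, written here in terms of power sums.
\<close>

lemma geo_lg_power_nth:
  "geo $ n = 1"
  "(geo * lg) $ n = H 1 n"
  "(geo * lg ^ 2) $ n = H 1 n ^ 2 - H 2 n"
  "(geo * lg ^ 3) $ n = H 1 n ^ 3 - 3 * H 1 n * H 2 n + 2 * H 3 n"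
  "(geo * lg ^ 4) $ n = H 1 n ^ 4 - 6 * H 1 n ^ 2 * H 2 n + 3 * H 2 n ^ 2
     + 8 * H 1 n * H 3 n - 6 * H 4 n"
proof -
  show geo: "geo $ n = 1" for n by (simp add: geo_def)
  define x where "x n = 1 / real (Suc n)" for n
  have H_Suc: "H k (Suc n) = H k n + x n ^ k" for k n
    by (simp add: H_def x_def power_one_over)
  have H_0: "H k 0 = 0" for k by (simp add: H_def)
  have step: "(geo * lg ^ k) $ Suc n = (geo * lg ^ k) $ n + real k * x n * (geo * lg ^ (k - 1)) $ n" for k n
    by (simp add: geo_lg_power_Suc x_def)
  note zero = geo_lg_power_0
  show 1: "(geo * lg) $ n = H 1 n" for n
    by (induction n) (use zero[of 1] step[of 1] in \<open>simp_all add: H_0 H_Suc geo\<close>)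
  have step2: "(geo * lg ^ 2) $ Suc n = (geo * lg ^ 2) $ n + 2 * x n * H 1 n" for n
    using step[of 2 n] 1 by simp
  show 2: "(geo * lg ^ 2) $ n = H 1 n ^ 2 - H 2 n" for n
  proof (induction n)
    case 0
    show ?case using zero[of 2] by (simp add: H_0)
  next
    case (Suc n)
    show ?case unfolding step2 Suc H_Suc by (simp add: algebra_simps eval_nat_numeral)
  qed
  have step3: "(geo * lg ^ 3) $ Suc n = (geo * lg ^ 3) $ n + 3 * x n * (H 1 n ^ 2 - H 2 n)" for n
    using step[of 3 n] 2 by simp
  show 3: "(geo * lg ^ 3) $ n = H 1 n ^ 3 - 3 * H 1 n * H 2 n + 2 * H 3 n" for n
  proof (induction n)
    case 0
    show ?case using zero[of 3] by (simp add: H_0)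
  next
    case (Suc n)
    show ?case unfolding step3 Suc H_Suc by (simp add: algebra_simps eval_nat_numeral)
  qed
  have step4: "(geo * lg ^ 4) $ Suc n = (geo * lg ^ 4) $ n
      + 4 * x n * (H 1 n ^ 3 - 3 * H 1 n * H 2 n + 2 * H 3 n)" for n
    using step[of 4 n] 3 by simp
  show "(geo * lg ^ 4) $ n = H 1 n ^ 4 - 6 * H 1 n ^ 2 * H 2 n + 3 * H 2 n ^ 2
     + 8 * H 1 n * H 3 n - 6 * H 4 n"
  proof (induction n)
    case 0
    show ?case using zero[of 4] by (simp add: H_0)
  next
    case (Suc n)
    show ?case unfolding step4 Suc H_Suc by (simp add: algebra_simps eval_nat_numeral)
  qed
qed

lemma theta_geo_power: "theta (geo ^ m) = of_nat m * geo ^ m * (geo - 1)"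
proof (induction m)
  case (Suc m)
  have "theta (geo ^ Suc m) = (geo ^ 2 - geo) * geo ^ m + geo * (of_nat m * geo ^ m * (geo - 1))"
    by (simp only: power_Suc theta_mult Suc theta_geo)
  also have "\<dots> = of_nat (Suc m) * geo ^ Suc m * (geo - 1)"
    unfolding of_nat_Suc power_Suc by algebra
  finally show ?case .
qed (simp add: theta_def)

text \<open>
  Comparing coefficients in \<open>theta (w^m L^k) = (w - 1) (m w^m L^k + k w^m L^(k - 1))\<close> raises the
  exponent of \<open>w\<close> without leaving the index \<open>n\<close>. For \<open>k = 0\<close> the truncated exponent \<open>k - 1\<close> is harmless, as
  these terms carry the factor \<open>k\<close>.
\<close>

lemma geo_lg_power_theta:
  "real m * (geo ^ Suc m * lg ^ k) $ n = (real n + real m) * (geo ^ m * lg ^ k) $ n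
     - real k * (geo ^ Suc m * lg ^ (k - 1)) $ n + real k * (geo ^ m * lg ^ (k - 1)) $ n"
proof -
  have "of_nat m * geo ^ Suc m * lg ^ k = theta (geo ^ m * lg ^ k) + of_nat m * (geo ^ m * lg ^ k)
     - of_nat k * (geo ^ Suc m * lg ^ (k - 1)) + of_nat k * (geo ^ m * lg ^ (k - 1))"
    by (simp add: theta_mult theta_geo_power theta_power[of lg] theta_lg algebra_simps)
  then have "(of_nat m * geo ^ Suc m * lg ^ k) $ n = \<dots> $ n" by simp
  then show ?thesis
    by (simp only: fps_of_nat[symmetric] mult.assoc fps_add_nth fps_sub_nth fps_mult_left_const_nth theta_nth)
       (simp add: distrib_right)
qed

section \<open>Generating functions of the binomial moments\<close>

definition moment_fps :: "nat \<Rightarrow> real fps" where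
  "moment_fps r = Abs_fps (binomial_moment r)"

lemma deriv_moment_fps:
  "fps_deriv (moment_fps r) = (\<Sum>i\<le>r. \<Sum>j\<le>i. binomial_theta j (moment_fps (i - j))
      * moment_fps (r - i))"
proof (rule fps_ext)
  fix n
  have "fps_deriv (moment_fps r) $ n = real (Suc n) * binomial_moment r (Suc n)"
    by (simp add: moment_fps_def)
  also have "\<dots> = (\<Sum>k\<le>n. \<Sum>i\<le>r. \<Sum>j\<le>i. real (k choose j) *
       binomial_moment (i - j) k * binomial_moment (r - i) (n - k))"
    by (subst binomial_moment_rec) (simp_all add: lessThan_Suc_atMost)
  also have "\<dots> = (\<Sum>i\<le>r. \<Sum>j\<le>i. \<Sum>k\<le>n. real (k choose j) *
       binomial_moment (i - j) k * binomial_moment (r - i) (n - k))"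
    by (subst sum.swap) (intro sum.cong refl sum.swap)
  also have "\<dots> = (\<Sum>i\<le>r. \<Sum>j\<le>i. binomial_theta j (moment_fps (i - j))
      * moment_fps (r - i)) $ n"
    by (simp add: fps_sum_nth fps_mult_nth binomial_theta_def moment_fps_def atMost_atLeast0)
  finally show "fps_deriv (moment_fps r) $ n =
    (\<Sum>i\<le>r. \<Sum>j\<le>i. binomial_theta j (moment_fps (i - j))
      * moment_fps (r - i)) $ n" .
qed

lemma moment_fps_0: "moment_fps 0 = geo"
  by (rule fps_ext) (simp add: moment_fps_def geo_def binomial_moment_def)

lemma moment_fps_nth_0: "r > 0 \<Longrightarrow> moment_fps r $ 0 = 0"
  by (simp add: moment_fps_def binomial_moment_def swaps_law.simps)

text \<open>
  The integrating factor is \<open>(1 - z)\<^sup>2\<close>: it turns the difference of two solutions into a power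
  series with vanishing derivative.
\<close>

lemma linear_ode_unique:
  fixes f g :: "real fps"
  assumes "fps_deriv f - 2 * geo * f = fps_deriv g - 2 * geo * g" "f $ 0 = g $ 0"
  shows "f = g"
proof -
  define h where "h = f - g"
  have ode: "fps_deriv h = 2 * geo * h" using assms(1) by (simp add: h_def algebra_simps)
  have "fps_deriv ((1 - fps_X)\<^sup>2 * h) = 2 * (1 - fps_X) * ((1 - fps_X) * geo - 1) * h"
    by (simp add: fps_deriv_power' ode power2_eq_square algebra_simps)
  also have "\<dots> = 0" by (simp add: one_minus_X_geo)
  finally have "(1 - fps_X)\<^sup>2 * h = fps_const (((1 - fps_X)\<^sup>2 * h) $ 0)"
    unfolding fps_deriv_eq_0_iff .
  also have "\<dots> = 0" using assms(2) by (simp add: h_def)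
  finally have "((1 - fps_X) * geo)\<^sup>2 * h = 0" by (simp add: power_mult_distrib)
  then show ?thesis by (simp add: one_minus_X_geo h_def)
qed


lemma binomial_theta_numeral_mult: "binomial_theta j (numeral k * f) = numeral k * binomial_theta j f"
  by (rule fps_ext) (simp add: binomial_theta_def numeral_fps_const)

lemma binomial_theta_1: "binomial_theta (Suc 0) f = theta f"
  using binomial_theta_Suc[of 0 f] by (simp add: binomial_theta_0)

lemma binomial_theta_2: "2 * binomial_theta 2 f = theta (theta f) - theta f"
  using binomial_theta_Suc[of 1 f] by (simp add: binomial_theta_1 numeral_2_eq_2)

lemma binomial_theta_3: "6 * binomial_theta 3 f = theta (theta (theta f)) - 3 * theta (theta f) + 2 * theta f"
proof -
  have "3 * binomial_theta 3 f = theta (binomial_theta 2 f) - 2 * binomial_theta 2 f"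
    using binomial_theta_Suc[of 2 f] by simp
  then have "6 * binomial_theta 3 f = theta (2 * binomial_theta 2 f) - 2 * (2 * binomial_theta 2 f)"
    unfolding theta_mult theta_numeral by algebra
  then show ?thesis unfolding binomial_theta_2 by (simp add: theta_diff)
qed

lemma binomial_theta_4:
  "24 * binomial_theta 4 f =
     theta (theta (theta (theta f))) - 6 * theta (theta (theta f)) + 11 * theta (theta f) - 6 * theta f"
proof -
  have "4 * binomial_theta 4 f = theta (binomial_theta 3 f) - 3 * binomial_theta 3 f"
    using binomial_theta_Suc[of 3 f] by simp
  then have "24 * binomial_theta 4 f = theta (6 * binomial_theta 3 f) - 3 * (6 * binomial_theta 3 f)"
    unfolding theta_mult theta_numeral by algebra
  then show ?thesis unfolding binomial_theta_3
    by (simp add: theta_add theta_diff theta_mult theta_numeral)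
qed

lemma theta_one: "theta 1 = 0" by (simp add: theta_def)

lemmas theta_rules = theta_add theta_diff theta_minus theta_mult theta_power theta_numeral theta_one
  theta_geo theta_lg

lemma geo_nth_0: "geo $ 0 = 1" by (simp add: geo_def)
lemma lg_nth_0: "lg $ 0 = 0" by (simp add: lg_def)

text \<open>
  The instances of the convolution equation that are needed, with the two occurrences of the unknown
  series collected in front.
\<close>

lemma deriv_moment_fps_1:
  "fps_deriv (moment_fps 1) = 2 * geo * moment_fps 1 + theta geo * geo"
  by (simp add: deriv_moment_fps moment_fps_0 binomial_theta_0 binomial_theta_1 algebra_simps)

lemma deriv_moment_fps_2:
  "fps_deriv (moment_fps 2) = 2 * geo * moment_fps 2 + (moment_fps 1 + theta geo) * moment_fps 1
     + (theta (moment_fps 1) + binomial_theta 2 geo) * geo"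
  by (simp add: deriv_moment_fps moment_fps_0 binomial_theta_0 binomial_theta_1 algebra_simps numeral_eq_Suc)

lemma deriv_moment_fps_3:
  "fps_deriv (moment_fps 3) = 2 * geo * moment_fps 3 + (moment_fps 1 + theta geo) * moment_fps 2
     + (moment_fps 2 + theta (moment_fps 1) + binomial_theta 2 geo) * moment_fps 1
     + (theta (moment_fps 2) + binomial_theta 2 (moment_fps 1) + binomial_theta 3 geo) * geo"
  by (simp add: deriv_moment_fps moment_fps_0 binomial_theta_0 binomial_theta_1 algebra_simps numeral_eq_Suc)

lemma deriv_moment_fps_4:
  "fps_deriv (moment_fps 4) = 2 * geo * moment_fps 4 + (moment_fps 1 + theta geo) * moment_fps 3
     + (moment_fps 2 + theta (moment_fps 1) + binomial_theta 2 geo) * moment_fps 2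
     + (moment_fps 3 + theta (moment_fps 2) + binomial_theta 2 (moment_fps 1)
        + binomial_theta 3 geo) * moment_fps 1
     + (theta (moment_fps 3) + binomial_theta 2 (moment_fps 2) + binomial_theta 3 (moment_fps 1)
        + binomial_theta 4 geo) * geo"
  by (simp add: deriv_moment_fps moment_fps_0 binomial_theta_0 binomial_theta_1 algebra_simps numeral_eq_Suc)

text \<open>
  The closed forms come from integrating
  \<open>((1 - z)\<^sup>2 F_r)' = (1 - z)\<^sup>2 R_r\<close>, where \<open>R_r\<close> collects the terms without \<open>F_r\<close>. The factors
  2, 12 and 72 clear the denominators, so that each verification is an identity between
  polynomials in \<open>w\<close> and \<open>L\<close> with integer coefficients.
\<close>

lemma moment_fps_1: "moment_fps 1 = geo - geo ^ 2 + geo ^ 2 * lg"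
proof (rule linear_ode_unique)
  show "fps_deriv (moment_fps 1) - 2 * geo * moment_fps 1 =
     fps_deriv (geo - geo ^ 2 + geo ^ 2 * lg) - 2 * geo * (geo - geo ^ 2 + geo ^ 2 * lg)"
    by (simp add: deriv_moment_fps_1[simplified] theta_rules fps_deriv_power' deriv_geo deriv_lg) algebra
qed (simp add: moment_fps_nth_0 fps_nth_power_0 geo_nth_0 lg_nth_0)

lemma moment_fps_2: "2 * moment_fps 2 = - 2 * geo ^ 2 - geo ^ 2 * lg ^ 2 + 2 * geo ^ 3 - 2 * geo ^ 3 * lg
      + 2 * geo ^ 3 * lg ^ 2" (is "_ = ?P")
proof (rule linear_ode_unique)
  have "fps_deriv (2 * moment_fps 2) - 2 * geo * (2 * moment_fps 2) =
      2 * (moment_fps 1 + theta geo) * moment_fps 1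
    + (2 * theta (moment_fps 1) + 2 * binomial_theta 2 geo) * geo"
    by (simp add: deriv_moment_fps_2[simplified] algebra_simps)
  also have "\<dots> = fps_deriv ?P - 2 * geo * ?P"
    unfolding binomial_theta_2 moment_fps_1
    by (simp add: theta_rules fps_deriv_power' deriv_geo deriv_lg) algebra
  finally show "fps_deriv (2 * moment_fps 2) - 2 * geo * (2 * moment_fps 2)
      = fps_deriv ?P - 2 * geo * ?P" .
qed (simp add: moment_fps_nth_0 fps_nth_power_0 geo_nth_0 lg_nth_0 fps_numeral_nth)

lemma moment_fps_3: "12 * moment_fps 3 =
      15 * geo ^ 2 + 18 * geo ^ 2 * lg + 12 * geo ^ 2 * lg ^ 2 + 2 * geo ^ 2 * lg ^ 3
      - 12 * geo ^ 3 - 24 * geo ^ 3 * lg - 18 * geo ^ 3 * lg ^ 2 - 12 * geo ^ 3 * lg ^ 3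
      - 3 * geo ^ 4 + 24 * geo ^ 4 * lg - 6 * geo ^ 4 * lg ^ 2 + 12 * geo ^ 4 * lg ^ 3" (is "_ = ?P")
proof (rule linear_ode_unique)
  have "fps_deriv (12 * moment_fps 3) - 2 * geo * (12 * moment_fps 3) =
      6 * (moment_fps 1 + theta geo) * (2 * moment_fps 2)
    + 6 * (2 * moment_fps 2 + 2 * theta (moment_fps 1) + 2 * binomial_theta 2 geo) * moment_fps 1
    + (6 * theta (2 * moment_fps 2) + 6 * (2 * binomial_theta 2 (moment_fps 1))
       + 2 * (6 * binomial_theta 3 geo)) * geo"
    by (simp add: deriv_moment_fps_3[simplified] theta_mult theta_numeral algebra_simps)
  also have "\<dots> = fps_deriv ?P - 2 * geo * ?P"
    unfolding binomial_theta_2 binomial_theta_3 moment_fps_2 moment_fps_1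
    by (simp add: theta_rules fps_deriv_power' deriv_geo deriv_lg) algebra
  finally show "fps_deriv (12 * moment_fps 3) - 2 * geo * (12 * moment_fps 3)
      = fps_deriv ?P - 2 * geo * ?P" .
qed (simp add: moment_fps_nth_0 fps_nth_power_0 geo_nth_0 lg_nth_0 fps_numeral_nth)

lemma moment_fps_4: "72 * moment_fps 4 =
      - 248 * geo ^ 2 - 366 * geo ^ 2 * lg - 216 * geo ^ 2 * lg ^ 2 - 48 * geo ^ 2 * lg ^ 3
      - 3 * geo ^ 2 * lg ^ 4 + 378 * geo ^ 3 + 684 * geo ^ 3 * lg + 576 * geo ^ 3 * lg ^ 2
      + 276 * geo ^ 3 * lg ^ 3 + 42 * geo ^ 3 * lg ^ 4 - 216 * geo ^ 4 - 594 * geo ^ 4 * lg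
      - 468 * geo ^ 4 * lg ^ 2 - 288 * geo ^ 4 * lg ^ 3 - 108 * geo ^ 4 * lg ^ 4
      + 86 * geo ^ 5 + 72 * geo ^ 5 * lg + 252 * geo ^ 5 * lg ^ 2 + 24 * geo ^ 5 * lg ^ 3
      + 72 * geo ^ 5 * lg ^ 4" (is "_ = ?P")
proof (rule linear_ode_unique)
  have "fps_deriv (72 * moment_fps 4) - 2 * geo * (72 * moment_fps 4) =
      6 * (moment_fps 1 + theta geo) * (12 * moment_fps 3)
    + 18 * (2 * moment_fps 2 + 2 * theta (moment_fps 1) + 2 * binomial_theta 2 geo) * (2 * moment_fps 2)
    + (6 * (12 * moment_fps 3) + 36 * theta (2 * moment_fps 2) + 36 * (2 * binomial_theta 2 (moment_fps 1))
       + 12 * (6 * binomial_theta 3 geo)) * moment_fps 1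
    + (6 * theta (12 * moment_fps 3) + 18 * (2 * binomial_theta 2 (2 * moment_fps 2))
       + 12 * (6 * binomial_theta 3 (moment_fps 1)) + 3 * (24 * binomial_theta 4 geo)) * geo"
    by (simp add: deriv_moment_fps_4[simplified] theta_mult theta_numeral
          binomial_theta_numeral_mult algebra_simps)
  also have "\<dots> = fps_deriv ?P - 2 * geo * ?P"
    unfolding binomial_theta_2 binomial_theta_3 binomial_theta_4 moment_fps_3 moment_fps_2 moment_fps_1
    by (simp add: theta_rules fps_deriv_power' deriv_geo deriv_lg) algebra
  finally show "fps_deriv (72 * moment_fps 4) - 2 * geo * (72 * moment_fps 4)
      = fps_deriv ?P - 2 * geo * ?P" .
qed (simp add: moment_fps_nth_0 fps_nth_power_0 geo_nth_0 lg_nth_0 fps_numeral_nth)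

section \<open>Closed forms of the moments\<close>

definition geo_lg_coeff :: "nat \<Rightarrow> nat \<Rightarrow> nat \<Rightarrow> real" where
  "geo_lg_coeff m k n = (geo ^ m * lg ^ k) $ n"

text \<open>
  Multiplication by one more factor \<open>w\<close>. The exponential generating function of \<open>w\<^sup>m L\<^sup>k\<close> over \<open>k\<close> is
  \<open>w\<^sup>m exp (y L)\<close>, that is, \<open>1 - z\<close> to the power \<open>- (m + y)\<close>, with coefficients
  \<open>(n + m + y - 1) gchoose n\<close>. Passing from \<open>m\<close> to \<open>m + 1\<close> multiplies these by
  \<open>(n + m + y) / (m + y) = 1 + n q / (1 + q y)\<close> with \<open>q = 1/m\<close>. Expanding \<open>1 / (1 + q y)\<close> in
  powers of \<open>y\<close> and comparing coefficients of \<open>y\<^sup>k/k!\<close> gives the formulas.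
\<close>

lemma geo_lg_coeff_Suc:
  fixes m n :: nat
  assumes "m > 0"
  defines "q \<equiv> 1 / real m" and "c \<equiv> (\<lambda>k. geo_lg_coeff m k n)"
  shows
    "geo_lg_coeff (Suc m) 0 n = c 0 + real n * q * c 0"
    "geo_lg_coeff (Suc m) 1 n = c 1 + real n * q * (c 1 - q * c 0)"
    "geo_lg_coeff (Suc m) 2 n = c 2 + real n * q * (c 2 - 2 * q * c 1 + 2 * q ^ 2 * c 0)"
    "geo_lg_coeff (Suc m) 3 n = c 3 + real n * q * (c 3 - 3 * q * c 2 + 6 * q ^ 2 * c 1
       - 6 * q ^ 3 * c 0)"
    "geo_lg_coeff (Suc m) 4 n = c 4 + real n * q * (c 4 - 4 * q * c 3 + 12 * q ^ 2 * c 2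
       - 24 * q ^ 3 * c 1 + 24 * q ^ 4 * c 0)"
proof -
  define d where "d k = geo_lg_coeff (Suc m) k n - c k" for k
  have step: "d k = q * (real n * c k - real k * d (k - 1))" for k
    using geo_lg_power_theta[of m k n] assms(1)
    by (simp add: d_def c_def q_def geo_lg_coeff_def field_simps)
  have d: "d 0 = q * (real n * c 0)" "d 1 = q * (real n * c 1 - d 0)"
    "d 2 = q * (real n * c 2 - 2 * d 1)" "d 3 = q * (real n * c 3 - 3 * d 2)"
    "d 4 = q * (real n * c 4 - 4 * d 3)"
    using step[of 0] step[of 1] step[of 2] step[of 3] step[of 4] by simp_all
  have split: "geo_lg_coeff (Suc m) k n = c k + d k" for k
    by (simp add: d_def)
  show "geo_lg_coeff (Suc m) 0 n = c 0 + real n * q * c 0"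
    and "geo_lg_coeff (Suc m) 1 n = c 1 + real n * q * (c 1 - q * c 0)"
    and "geo_lg_coeff (Suc m) 2 n = c 2 + real n * q * (c 2 - 2 * q * c 1 + 2 * q ^ 2 * c 0)"
    and "geo_lg_coeff (Suc m) 3 n = c 3 + real n * q * (c 3 - 3 * q * c 2 + 6 * q ^ 2 * c 1
       - 6 * q ^ 3 * c 0)"
    and "geo_lg_coeff (Suc m) 4 n = c 4 + real n * q * (c 4 - 4 * q * c 3 + 12 * q ^ 2 * c 2
       - 24 * q ^ 3 * c 1 + 24 * q ^ 4 * c 0)"
    unfolding split d by algebra+
qed

lemma geo_lg_coeff_1:
  "geo_lg_coeff 1 0 n = 1"
  "geo_lg_coeff 1 1 n = H 1 n"
  "geo_lg_coeff 1 2 n = H 1 n ^ 2 - H 2 n"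
  "geo_lg_coeff 1 3 n = H 1 n ^ 3 - 3 * H 1 n * H 2 n + 2 * H 3 n"
  "geo_lg_coeff 1 4 n = H 1 n ^ 4 - 6 * H 1 n ^ 2 * H 2 n + 3 * H 2 n ^ 2
     + 8 * H 1 n * H 3 n - 6 * H 4 n"
  by (simp_all add: geo_lg_coeff_def geo_lg_power_nth[simplified])

lemma Suc_numerals: "Suc 1 = 2" "Suc 2 = 3" "Suc 3 = 4" "Suc 4 = 5"
  by simp_all

text \<open>
  These rules reduce the coefficients with \<open>m \<le> 5\<close> and \<open>k \<le> 4\<close> to harmonic numbers, descending to
  \<open>m = 1\<close> one row at a time. The condition on \<open>m\<close> is discharged and the successors are evaluated
  beforehand so that they apply as unconditional rewrite rules.
\<close>

lemmas geo_lg_coeff_eval =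
  geo_lg_coeff_Suc[of 4, unfolded Suc_numerals, OF zero_less_numeral]
  geo_lg_coeff_Suc[of 3, unfolded Suc_numerals, OF zero_less_numeral]
  geo_lg_coeff_Suc[of 2, unfolded Suc_numerals, OF zero_less_numeral]
  geo_lg_coeff_Suc[of 1, unfolded Suc_numerals, OF zero_less_one]
  geo_lg_coeff_1

lemma geo_lg_coeff_fold:
  "geo ^ m $ n = geo_lg_coeff m 0 n"
  "(geo ^ m * lg) $ n = geo_lg_coeff m 1 n"
  "(geo ^ m * lg ^ k) $ n = geo_lg_coeff m k n"
  "geo $ n = geo_lg_coeff 1 0 n"
  by (simp_all add: geo_lg_coeff_def)

lemmas fps_nth_eval =
   mult.assoc fps_add_nth fps_sub_nth fps_neg_nth numeral_fps_const neg_numeral_fps_const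
   fps_mult_left_const_nth
   fps_const_neg[symmetric] mult_minus_left geo_lg_coeff_fold
   moment_fps_def[THEN arg_cong[where f = "\<lambda>f. f $ n" for n], simplified]

lemma binomial_moment_1: "binomial_moment 1 n = (real n + 1) * H 1 n - 2 * real n"
  using moment_fps_1[THEN arg_cong[where f = "\<lambda>f. f $ n"]]
  by (simp only: fps_nth_eval)
      (simp only: geo_lg_coeff_eval of_nat_1 div_by_1 power_one, simp add: algebra_simps)

text \<open>
  The variable \<open>N = n + 1\<close> is natural here: the harmonic numbers of top weight, such as \<open>H 2 n\<close> and
  \<open>H 1 n ^ 2\<close> in the second moment, come with a pure power of \<open>N\<close>.
\<close>

lemma binomial_moment_2:
  fixes n :: nat defines "N \<equiv> real n + 1"
  shows "2 * binomial_moment 2 n =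
     (6 * N ^ 2 - 6 * N) - (4 * N ^ 2 - 2 * N) * H 1 n - N ^ 2 * H 2 n + N ^ 2 * H 1 n ^ 2" (is "_ = ?R")
proof -
  have n: "real n = N - 1" by (simp add: N_def)
  have "2 * binomial_moment 2 n = (2 * moment_fps 2) $ n"
    by (simp add: moment_fps_def numeral_fps_const)
  also have "\<dots> = ?R"
    unfolding moment_fps_2
    by (simp only: fps_nth_eval)
      (simp only: geo_lg_coeff_eval n of_nat_numeral of_nat_1
        div_by_1 power_one mult_1 mult_1_right, algebra)
  finally show ?thesis .
qed

lemma binomial_moment_3:
  fixes n :: nat defines "N \<equiv> real n + 1"
  shows "24 * binomial_moment 3 n =
     - (89 * N ^ 3 - 45 * N ^ 2 - 32 * N - 12) + (72 * N ^ 3 - 24 * N ^ 2 - 12 * N) * H 1 n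
      + 24 * N ^ 3 * H 2 n - 24 * N ^ 3 * H 1 n ^ 2 + 8 * N ^ 3 * H 3 n
      - 12 * N ^ 3 * H 1 n * H 2 n + 4 * N ^ 3 * H 1 n ^ 3" (is "_ = ?R")
proof -
  have n: "real n = N - 1" by (simp add: N_def)
  have "24 * binomial_moment 3 n = 2 * (12 * moment_fps 3) $ n"
    by (simp add: moment_fps_def numeral_fps_const)
  also have "\<dots> = ?R"
    unfolding moment_fps_3
    by (simp only: fps_nth_eval)
      (simp only: geo_lg_coeff_eval n of_nat_numeral of_nat_1
        div_by_1 power_one mult_1 mult_1_right, algebra)
  finally show ?thesis .
qed

lemma binomial_moment_4:
  fixes n :: nat defines "N \<equiv> real n + 1"
  shows "432 * binomial_moment 4 n =
     (1811 * N ^ 4 + 399 * N ^ 3 - 842 * N ^ 2 - 792 * N - 576)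
      - (1602 * N ^ 4 + 486 * N ^ 3 - 576 * N ^ 2 - 288 * N) * H 1 n
      - (648 * N ^ 4 + 216 * N ^ 3) * H 2 n + (648 * N ^ 4 + 216 * N ^ 3) * H 1 n ^ 2
      - (288 * N ^ 4 + 144 * N ^ 3) * H 3 n + (432 * N ^ 4 + 216 * N ^ 3) * H 1 n * H 2 n
      - (144 * N ^ 4 + 72 * N ^ 3) * H 1 n ^ 3 - 108 * N ^ 4 * H 4 n + 54 * N ^ 4 * H 2 n ^ 2
      + 144 * N ^ 4 * H 1 n * H 3 n - 108 * N ^ 4 * H 1 n ^ 2 * H 2 n + 18 * N ^ 4 * H 1 n ^ 4" (is "_ = ?R")
proof -
  have n: "real n = N - 1" by (simp add: N_def)
  have "432 * binomial_moment 4 n = 6 * (72 * moment_fps 4) $ n"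
    by (simp add: moment_fps_def numeral_fps_const)
  also have "\<dots> = ?R"
    unfolding moment_fps_4
    by (simp only: fps_nth_eval)
      (simp only: geo_lg_coeff_eval n of_nat_numeral of_nat_1
        div_by_1 power_one mult_1 mult_1_right, algebra)
  finally show ?thesis .
qed

text \<open>
  The identity \<open>expand\<close> in the proof writes \<open>(x - m)\<^sup>4\<close> in the binomial basis; the coefficients
  24, 36, 14, 1 of the case \<open>m = 0\<close> are \<open>j! S(4, j)\<close> with Stirling numbers of the second kind.
\<close>

lemma central_moment_4_eq:
  assumes "finite A" "card A = n"
  defines "b \<equiv> (\<lambda>r. binomial_moment r n)"
  shows "central_moment 4 (swaps_pmf A) = 24 * b 4 + 36 * b 3 + 14 * b 2 + b 1
    - 4 * b 1 * (6 * b 3 + 6 * b 2 + b 1) + 6 * b 1 ^ 2 * (2 * b 2 + b 1) - 3 * b 1 ^ 4"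
proof -
  have X: "swaps_pmf A = swaps_law n" using assms swaps_pmf_eq_swaps_law by blast
  have int: "integrable (measure_pmf (swaps_law n)) f" for f :: "nat \<Rightarrow> real"
    by (rule integrable_measure_pmf_finite) (simp add: finite_set_pmf_swaps_law)
  have mean: "mean (swaps_pmf A) = b 1"
    by (simp add: X mean_def b_def binomial_moment_def)
  have expand: "(real x - m) ^ 4 = 24 * real (x choose 4) + (36 - 24 * m) * real (x choose 3)
      + (14 - 24 * m + 12 * m ^ 2) * real (x choose 2)
      + (1 - 4 * m + 6 * m ^ 2 - 4 * m ^ 3) * real (x choose 1) + m ^ 4"
    for x m
  proof -
    have c2: "2 * real (x choose 2) = real x * (real x - 1)"
      and c3: "6 * real (x choose 3) = real x * (real x - 1) * (real x - 2)"
      and c4: "24 * real (x choose 4) = real x * (real x - 1) * (real x - 2) * (real x - 3)"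
      by (simp_all add: binomial_gbinomial gbinomial_prod_rev numeral_eq_Suc)
    show ?thesis using c2 c3 c4 by simp algebra
  qed
  have "central_moment 4 (swaps_pmf A) = 24 * b 4 + (36 - 24 * b 1) * b 3
      + (14 - 24 * b 1 + 12 * b 1 ^ 2) * b 2 + (1 - 4 * b 1 + 6 * b 1 ^ 2 - 4 * b 1 ^ 3) * b 1 + b 1 ^ 4"
    unfolding central_moment_def mean unfolding X expand
    by (simp add: int) (simp add: b_def binomial_moment_def)
  then show ?thesis by algebra
qed

theorem theorem4p8:
  fixes A :: "'a::linorder set" and n :: nat
  assumes "finite A" and "card A = n" and "n \<ge> 1"
  shows "central_moment 4 (swaps_pmf A) =
      1 / 18 * real n * (335 * real n ^ 3 + 1568 * real n ^ 2 + 3067 * real n + 2770)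
      - 3 * (real n + 1) * (4 * real n ^ 2 + 8 * real n + 9) * H 1 n
      + 3 * (real n + 1) ^ 2 * H 1 n ^ 2
      + (- (12 * real n ^ 2 + 24 * real n + 19) * (real n + 1) ^ 2
         + 6 * (real n + 1) ^ 3 * H 1 n) * H 2 n
      + 3 * (real n + 1) ^ 4 * H 2 n ^ 2
      - 12 * (real n + 1) ^ 3 * H 3 n
      - 6 * (real n + 1) ^ 4 * H 4 n"
proof -
  \<comment> \<open>The multiples 432, 24 and 2 let the closed forms be substituted without fractions.\<close>
  have "18 * central_moment 4 (swaps_pmf A) =
    432 * binomial_moment 4 n + 27 * (24 * binomial_moment 3 n)
    + 126 * (2 * binomial_moment 2 n) + 18 * binomial_moment 1 n
    - 72 * binomial_moment 1 n * (binomial_moment 1 n) + 108 * binomial_moment 1 n ^ 3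
    - 18 * binomial_moment 1 n * (24 * binomial_moment 3 n)
    - 216 * binomial_moment 1 n * (2 * binomial_moment 2 n)
    + 108 * binomial_moment 1 n ^ 2 * (2 * binomial_moment 2 n) - 54 * binomial_moment 1 n ^ 4"
    unfolding central_moment_4_eq[OF assms(1,2)] by algebra
  then show ?thesis unfolding binomial_moment_1 binomial_moment_2 binomial_moment_3 binomial_moment_4
    by algebra
qed

end
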